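(* Let $M=\{1^{p_1},2^{p_2},\dots,n^{p_n}\}$ with $p_1,\dots,p_n$ positive integers. There exists an involution $T\mapsto\widetilde T$ on $\mathcal{T}_M$ such that $$(\mathsf{odd},\mathsf{oe},\mathsf{ee})(T)=(\mathsf{oe},\mathsf{odd},\mathsf{ee})(\widetilde T)\quad\text{for each } T\in\mathcal{T}_M.$$ Consequently, $$\sum_{T\in\mathcal{T}_M}x^{\mathsf{ee}(T)}y^{\mathsf{oe}(T)}z^{\mathsf{odd}(T)}=\sum_{T\in\mathcal{T}_M}x^{\mathsf{ee}(T)}y^{\mathsf{odd}(T)}z^{\mathsf{oe}(T)}.$$
   Context: A plane tree is a rooted tree in which the children of every node are linearly ordered (left to right). With $p=p_1+\cdots+p_n$, a weakly increasing tree on $M$ is a plane tree with $p+1$ nodes labeled by the elements of the multiset $M\cup\{0\}$ (with multiplicity) such that labels weakly increase along every root-to-leaf path and the labels of the children of each node weakly increase from left to right. $\mathcal{T}_M$ is the set of such trees. The degree of a node is its number of children; the level of a node is its distance from the root (root at level $0$). For a tree $T$: $\mathsf{odd}(T)$ is the number of odd-degree nodes; $\mathsf{oe}(T)$ is the number of even-degree nodes on odd levels; $\mathsf{ee}(T)$ is the number of even-degree nodes on even levels. *)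

theory Defs
  imports "HOL-Library.Multiset" "HOL-Library.FuncSet"
begin

datatype plane_tree = Node (label: nat) (children: "plane_tree list")

definition deg :: "plane_tree \<Rightarrow> nat" where
  "deg T = length (children T)"

text \<open>A node is represented by its level together with the subtree rooted at it.  The list
  \<open>nodes_from l T\<close> has one entry per node of \<open>T\<close>, so equal subtrees are counted with
  multiplicity; \<open>l\<close> is the level assigned to the root of \<open>T\<close>.\<close>

fun nodes_from :: "nat \<Rightarrow> plane_tree \<Rightarrow> (nat \<times> plane_tree) list" where
  "nodes_from l (Node a ts) = (l, Node a ts) # concat (map (nodes_from (Suc l)) ts)"

abbreviation nodes :: "plane_tree \<Rightarrow> (nat \<times> plane_tree) list" where
  "nodes T \<equiv> nodes_from 0 T"

definition labels :: "plane_tree \<Rightarrow> nat multiset" where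
  "labels T = mset (map (\<lambda>(l, v). label v) (nodes T))"

text \<open>The label sequences read along the root-to-leaf paths.\<close>

fun paths :: "plane_tree \<Rightarrow> nat list list" where
  "paths (Node a ts) = (if ts = [] then [[a]] else map ((#) a) (concat (map paths ts)))"

definition weakly_increasing :: "plane_tree \<Rightarrow> bool" where
  "weakly_increasing T \<longleftrightarrow>
     (\<forall>as \<in> set (paths T). sorted as) \<and>
     (\<forall>(l, v) \<in> set (nodes T). sorted (map label (children v)))"

definition weakly_increasing_trees :: "nat multiset \<Rightarrow> plane_tree set" where
  "weakly_increasing_trees M = {T. labels T = M + {#0#} \<and> weakly_increasing T}"

definition odd_nodes :: "plane_tree \<Rightarrow> nat" where
  "odd_nodes T = length (filter (\<lambda>(l, v). odd (deg v)) (nodes T))"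

definition oe :: "plane_tree \<Rightarrow> nat" where
  "oe T = length (filter (\<lambda>(l, v). odd l \<and> even (deg v)) (nodes T))"

definition ee :: "plane_tree \<Rightarrow> nat" where
  "ee T = length (filter (\<lambda>(l, v). even l \<and> even (deg v)) (nodes T))"

text \<open>The multiset \<open>{1\<^bsup>p 1\<^esup>, \<dots>, n\<^bsup>p n\<^esup>}\<close>.\<close>

definition multiset_of_mults :: "nat \<Rightarrow> (nat \<Rightarrow> nat) \<Rightarrow> nat multiset" where
  "multiset_of_mults n p = (\<Sum>i = 1..n. replicate_mset (p i) i)"

text \<open>Finiteness, so that sums over \<open>weakly_increasing_trees M\<close> are genuine sums.\<close>

lemma length_nodes_from: "length (nodes_from l T) = length (nodes_from l' T)"
proof (induction T arbitrary: l l')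
  case (Node a ts)
  have "map (length \<circ> nodes_from (Suc l)) ts = map (length \<circ> nodes_from (Suc l')) ts"
    using Node.IH by auto
  then show ?case by (simp only: nodes_from.simps length_Cons length_concat map_map)
qed

lemma label_nodes_from:
  "(\<lambda>(l, v). label v) ` set (nodes_from l T) = (\<lambda>(l, v). label v) ` set (nodes_from l' T)"
proof (induction T arbitrary: l l')
  case (Node a ts)
  then have "(\<Union>t\<in>set ts. (\<lambda>(l, v). label v) ` set (nodes_from (Suc l) t)) =
      (\<Union>t\<in>set ts. (\<lambda>(l, v). label v) ` set (nodes_from (Suc l') t))"
    by (intro SUP_cong refl) blast
  then show ?case by (simp add: image_UN)
qed

lemma finite_trees_bounded:
  assumes "finite A"
  shows "finite {T. (\<lambda>(l, v). label v) ` set (nodes T) \<subseteq> A \<and> length (nodes T) \<le> k}"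
    (is "finite (?S k)")
proof (induction k)
  case 0
  have "length (nodes T) \<noteq> 0" for T by (cases T) simp
  then show ?case by simp
next
  case (Suc k)
  have "?S (Suc k) \<subseteq>
      (\<lambda>(a, ts). Node a ts) ` (A \<times> {ts. set ts \<subseteq> ?S k \<and> length ts \<le> k})"
  proof
    fix T assume T: "T \<in> ?S (Suc k)"
    obtain a ts where [simp]: "T = Node a ts" by (cases T)
    have len: "(\<Sum>t\<leftarrow>ts. length (nodes_from (Suc 0) t)) \<le> k"
      using T by (simp add: length_concat comp_def)
    have pos: "1 \<le> length (nodes_from (Suc 0) t)" for t by (cases t) simp
    have "length ts = (\<Sum>t\<leftarrow>ts. 1)" by (simp add: sum_list_triv)
    also have "\<dots> \<le> (\<Sum>t\<leftarrow>ts. length (nodes_from (Suc 0) t))"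
      using pos by (intro sum_list_mono)
    finally have 1: "length ts \<le> k" using len by simp
    have "t \<in> ?S k" if "t \<in> set ts" for t
    proof -
      have "length (nodes_from (Suc 0) t) \<le> (\<Sum>t\<leftarrow>ts. length (nodes_from (Suc 0) t))"
        using that by (intro member_le_sum_list) auto
      then have "length (nodes t) \<le> k"
        using len length_nodes_from[of 0 t "Suc 0"] by simp
      moreover have "(\<lambda>(l, v). label v) ` set (nodes_from (Suc 0) t) \<subseteq> A"
        using T that by auto
      ultimately show ?thesis using label_nodes_from[of 0 t "Suc 0"] by simp
    qed
    then show "T \<in> (\<lambda>(a, ts). Node a ts) ` (A \<times> {ts. set ts \<subseteq> ?S k \<and> length ts \<le> k})"
      using 1 T by (intro image_eqI[where x = "(a, ts)"]) auto
  qed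
  moreover have "finite ((\<lambda>(a, ts). Node a ts) `
      (A \<times> {ts. set ts \<subseteq> ?S k \<and> length ts \<le> k}))"
    by (intro finite_imageI finite_cartesian_product finite_lists_length_le assms Suc)
  ultimately show ?case by (rule finite_subset)
qed

lemma finite_weakly_increasing_trees: "finite (weakly_increasing_trees M)"
proof (rule finite_subset[OF _ finite_trees_bounded[of "set_mset (M + {#0#})" "size M + 1"]])
  have "(\<lambda>(l, v). label v) ` set (nodes T) = set_mset (M + {#0#}) \<and>
        length (nodes T) = size M + 1"
    if "labels T = M + {#0#}" for T
  proof
    have "set_mset (labels T) = (\<lambda>(l, v). label v) ` set (nodes T)"
      by (simp add: labels_def)
    then show "(\<lambda>(l, v). label v) ` set (nodes T) = set_mset (M + {#0#})"
      using that by simp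
    have "size (labels T) = length (nodes T)"
      by (simp add: labels_def)
    then show "length (nodes T) = size M + 1" using that by simp
  qed
  then show "weakly_increasing_trees M \<subseteq>
      {T. (\<lambda>(l, v). label v) ` set (nodes T) \<subseteq> set_mset (M + {#0#}) \<and>
          length (nodes T) \<le> size M + 1}"
    unfolding weakly_increasing_trees_def by (intro Collect_mono) simp
qed simp

end

theory Submission
  imports Defs
begin

text \<open>Reading a forest \<open>Node a us # ts\<close> as a binary node \<open>a\<close> with left subtree \<open>us\<close> and right
  subtree \<open>ts\<close> turns weakly increasing trees into binary trees whose labels weakly increase away
  from the root; this condition is invariant under exchanging left and right subtrees. Every
  plane-tree node (root included) corresponds to an empty subtree: the end of the list of its
  children. Give a subtree the state \<open>(l, d)\<close>, where \<open>l\<close> is the level parity of the common parent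
  and \<open>d\<close> the parity of the number of earlier siblings. An empty subtree in state
  \<open>x = (0,0)\<close>, \<open>y = (1,0)\<close>, \<open>z = (0,1)\<close>, \<open>z' = (1,1)\<close> then contributes to \<open>ee\<close>, \<open>oe\<close>, \<open>odd\<close>, \<open>odd\<close>
  respectively, and the states of the left and right subtrees are determined by the rules
  \<open>x \<rightarrow> (y, z)\<close>, \<open>z \<rightarrow> (y, x)\<close>, \<open>y \<rightarrow> (x, z')\<close>, \<open>z' \<rightarrow> (x, y)\<close>. Up to the order of the subtrees
  this is Schett's grammar \<open>x \<rightarrow> yz\<close>, \<open>y \<rightarrow> xz\<close>, \<open>z \<rightarrow> xy\<close>, which is symmetric in \<open>y\<close> and \<open>z\<close>;
  exchanging subtrees where necessary realises this symmetry as an involution.\<close>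

lemma forest_induct [case_names Nil Cons]:
  assumes "P []" and "\<And>a us ts. P us \<Longrightarrow> P ts \<Longrightarrow> P (Node a us # ts)"
  shows "P ts"
proof (induction "size_list size ts" arbitrary: ts rule: less_induct)
  case less
  show ?case
  proof (cases ts)
    case Nil
    then show ?thesis using assms(1) by simp
  next
    case (Cons t ts')
    obtain a us where "t = Node a us" by (cases t)
    with Cons less assms(2) show ?thesis by simp
  qed
qed

text \<open>\<open>swap_st\<close> sends a forest in state \<open>s\<close> to one in state \<open>t\<close>; \<open>swap_yz'\<close> serves for both
  \<open>y \<rightarrow> z'\<close> and \<open>z' \<rightarrow> y\<close>.\<close>

function swap_xx swap_yz swap_zy swap_yz' :: "plane_tree list \<Rightarrow> plane_tree list" where
  "swap_xx [] = []"
| "swap_xx (Node a us # ts) = Node a (swap_zy ts) # swap_yz us"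
| "swap_yz [] = []"
| "swap_yz (Node a us # ts) = Node a (swap_yz' ts) # swap_xx us"
| "swap_zy [] = []"
| "swap_zy (Node a us # ts) = Node a (swap_xx ts) # swap_yz' us"
| "swap_yz' [] = []"
| "swap_yz' (Node a us # ts) = Node a (swap_xx us) # swap_yz' ts"
  by pat_completeness auto
termination
  by (relation "measure (case_sum (case_sum (size_list size) (size_list size))
        (case_sum (size_list size) (size_list size)))") simp_all

lemma swap_swap:
  "swap_xx (swap_xx ts) = ts \<and> swap_zy (swap_yz ts) = ts \<and> swap_yz (swap_zy ts) = ts \<and>
   swap_yz' (swap_yz' ts) = ts"
  by (induction ts rule: forest_induct) auto

fun forest_labels :: "plane_tree list \<Rightarrow> nat multiset" where
  "forest_labels [] = {#}"
| "forest_labels (Node a us # ts) = add_mset a (forest_labels us + forest_labels ts)"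

lemma forest_labels_swap:
  "forest_labels (swap_xx ts) = forest_labels ts \<and> forest_labels (swap_yz ts) = forest_labels ts \<and>
   forest_labels (swap_zy ts) = forest_labels ts \<and> forest_labels (swap_yz' ts) = forest_labels ts"
  by (induction ts rule: forest_induct) auto

fun increasing_above :: "nat \<Rightarrow> plane_tree list \<Rightarrow> bool" where
  "increasing_above b [] \<longleftrightarrow> True"
| "increasing_above b (Node a us # ts) \<longleftrightarrow> b \<le> a \<and> increasing_above a us \<and> increasing_above a ts"

lemma increasing_above_swap:
  "increasing_above b (swap_xx ts) = increasing_above b ts \<and>
   increasing_above b (swap_yz ts) = increasing_above b ts \<and>
   increasing_above b (swap_zy ts) = increasing_above b ts \<and>
   increasing_above b (swap_yz' ts) = increasing_above b ts"
  by (induction ts arbitrary: b rule: forest_induct) auto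

text \<open>Sums \<open>f\<close> over the states of all empty subtrees; parities are encoded as truth values,
  \<open>True\<close> being odd.\<close>

fun tally :: "(bool \<Rightarrow> bool \<Rightarrow> nat) \<Rightarrow> bool \<Rightarrow> bool \<Rightarrow> plane_tree list \<Rightarrow> nat" where
  "tally f l d [] = f l d"
| "tally f l d (Node a us # ts) = tally f (\<not> l) False us + tally f l (\<not> d) ts"

text \<open>The weights \<open>f\<close> and \<open>g\<close> differ by exchanging y and z, each
  being equal on z and z'. The last two conjuncts are the two uses of
  \<open>swap_yz'\<close>.\<close>

lemma tally_swap:
  assumes "f False True = f True True" "g False True = g True True"
    and "g False False = f False False" "g True False = f True True" "g True True = f True False"
  shows "tally g False False (swap_xx ts) = tally f False False ts \<and>
    tally g False True (swap_yz ts) = tally f True False ts \<and>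
    tally g True False (swap_zy ts) = tally f False True ts \<and>
    tally g True True (swap_yz' ts) = tally f True False ts \<and>
    tally g True False (swap_yz' ts) = tally f True True ts"
  using assms by (induction ts rule: forest_induct) auto

lemma map_snd_nodes_from: "map snd (nodes_from l T) = map snd (nodes_from l' T)"
proof (induction T arbitrary: l l')
  case (Node a ts)
  then have "map (map snd \<circ> nodes_from (Suc l)) ts = map (map snd \<circ> nodes_from (Suc l')) ts"
    by auto
  then show ?case by (simp only: nodes_from.simps list.map map_concat map_map snd_conv)
qed

lemma labels_Node: "labels (Node a ts) = add_mset a (\<Sum>t\<leftarrow>ts. labels t)"
proof -
  have "map (\<lambda>(l, v). label v) (nodes_from 1 t) = map (\<lambda>(l, v). label v) (nodes t)" for t
    using arg_cong[OF map_snd_nodes_from[of 1 t 0], of "map label"]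
    by (simp add: comp_def case_prod_unfold)
  then show ?thesis
    by (simp add: labels_def map_concat mset_concat comp_def)
qed

lemma forest_labels_eq: "forest_labels ts = (\<Sum>t\<leftarrow>ts. labels t)"
  by (induction ts rule: forest_induct) (simp_all add: labels_Node)

lemma paths_nonempty: "paths T \<noteq> []"
proof (induction T)
  case (Node a ts)
  then show ?case by (cases ts) auto
qed

lemma hd_paths: "as \<in> set (paths T) \<Longrightarrow> \<exists>bs. as = label T # bs"
  by (cases T) (auto split: if_splits)

lemma sorted_paths_Node:
  "(\<forall>as \<in> set (paths (Node a ts)). sorted as) \<longleftrightarrow>
   (\<forall>t \<in> set ts. a \<le> label t \<and> (\<forall>as \<in> set (paths t). sorted as))"
proof -
  have "(\<forall>as \<in> set (paths t). sorted (a # as)) \<longleftrightarrow>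
      a \<le> label t \<and> (\<forall>as \<in> set (paths t). sorted as)" for t
  proof -
    have "sorted (a # as) \<longleftrightarrow> a \<le> label t \<and> sorted as" if "as \<in> set (paths t)" for as
      using hd_paths[OF that] by fastforce
    moreover have "\<exists>as. as \<in> set (paths t)"
      using paths_nonempty[of t] by (meson list.set_sel(1))
    ultimately show ?thesis by blast
  qed
  then show ?thesis by (auto simp del: sorted_wrt.simps) simp_all
qed

lemma weakly_increasing_Node:
  "weakly_increasing (Node a ts) \<longleftrightarrow>
   sorted (a # map label ts) \<and> (\<forall>t \<in> set ts. weakly_increasing t)"
proof -
  have "(\<forall>(l, v) \<in> set (nodes_from 1 t). sorted (map label (children v))) \<longleftrightarrow>
      (\<forall>(l, v) \<in> set (nodes t). sorted (map label (children v)))" for t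
  proof -
    have "snd ` set (nodes_from 1 t) = snd ` set (nodes t)"
      using arg_cong[OF map_snd_nodes_from[of 1 t 0], of set] by simp
    then have "(\<forall>v \<in> snd ` set (nodes_from 1 t). sorted (map label (children v))) \<longleftrightarrow>
      (\<forall>v \<in> snd ` set (nodes t). sorted (map label (children v)))" by simp
    then show ?thesis by (simp add: case_prod_unfold)
  qed
  then show ?thesis
    unfolding weakly_increasing_def sorted_paths_Node by auto
qed

text \<open>Siblings form a chain, so bounding later siblings by the first one's label is no
  loss.\<close>

lemma increasing_above_iff:
  "increasing_above b ts \<longleftrightarrow>
   sorted (b # map label ts) \<and> (\<forall>t \<in> set ts. weakly_increasing t)"
  by (induction ts arbitrary: b rule: forest_induct) (fastforce simp: weakly_increasing_Node)+

lemma sum_list_concat: "sum_list (concat xss) = (\<Sum>xs\<leftarrow>xss. sum_list xs)"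
  by (induction xss) simp_all

text \<open>Each tree of \<open>ts\<close> flips \<open>d\<close>, so the end of the list sees the
  degree parity of the common parent, at level \<open>l\<close>.\<close>

lemma tally_eq:
  "tally f (odd l) d ts = f (odd l) (d \<noteq> odd (length ts)) +
   (\<Sum>t\<leftarrow>ts. \<Sum>(k, v)\<leftarrow>nodes_from (Suc l) t. f (odd k) (odd (deg v)))"
proof (induction ts arbitrary: l d rule: forest_induct)
  case Nil
  then show ?case by simp
next
  case (Cons a us ts)
  show ?case
    using Cons(1)[of "Suc l" False] Cons(2)[of l "\<not> d"]
    by (simp add: deg_def map_concat sum_list_concat comp_def)
qed

lemma tally_children:
  "length (filter (\<lambda>(l, v). P (odd l) (odd (deg v))) (nodes (Node a ts))) =
   tally (\<lambda>l d. of_bool (P l d)) False False ts"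
proof -
  have filter: "length (filter (\<lambda>(l, v). P (odd l) (odd (deg v))) xs) =
      (\<Sum>(l, v)\<leftarrow>xs. of_bool (P (odd l) (odd (deg v))))" for xs :: "(nat \<times> plane_tree) list"
    by (induction xs) auto
  show ?thesis
    using tally_eq[of "\<lambda>l d. of_bool (P l d)" 0 False ts] unfolding filter
    by (simp add: deg_def map_concat sum_list_concat comp_def)
qed

fun swap_tree :: "plane_tree \<Rightarrow> plane_tree" where
  "swap_tree (Node a ts) = Node a (swap_xx ts)"

lemma swap_tree_swap_tree: "swap_tree (swap_tree T) = T"
  by (cases T) (simp add: swap_swap)

lemma swap_tree_in_weakly_increasing_trees:
  assumes "T \<in> weakly_increasing_trees M"
  shows "swap_tree T \<in> weakly_increasing_trees M"
  using assms
  by (cases T)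
    (simp add: weakly_increasing_trees_def labels_Node weakly_increasing_Node
      flip: forest_labels_eq increasing_above_iff sorted_wrt.simps
      add: forest_labels_swap increasing_above_swap)

lemma statistics_swap_tree:
  "odd_nodes (swap_tree T) = oe T" "oe (swap_tree T) = odd_nodes T" "ee (swap_tree T) = ee T"
proof -
  obtain a ts where T: "T = Node a ts" by (cases T)
  have odd_nodes: "odd_nodes (Node a ts) = tally (\<lambda>l d. of_bool d) False False ts"
    and oe: "oe (Node a ts) = tally (\<lambda>l d. of_bool (l \<and> \<not> d)) False False ts"
    and ee: "ee (Node a ts) = tally (\<lambda>l d. of_bool (\<not> l \<and> \<not> d)) False False ts" for a ts
    using tally_children[of "\<lambda>l d. d" a ts] tally_children[of "\<lambda>l d. l \<and> \<not> d" a ts]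
      tally_children[of "\<lambda>l d. \<not> l \<and> \<not> d" a ts]
    by (simp_all add: odd_nodes_def oe_def ee_def)
  show "odd_nodes (swap_tree T) = oe T" "oe (swap_tree T) = odd_nodes T" "ee (swap_tree T) = ee T"
    unfolding T swap_tree.simps odd_nodes oe ee
    \<comment> \<open>Exchanging y and z swaps the indicators of \<open>odd_nodes\<close> and
      \<open>oe\<close> and fixes that of \<open>ee\<close>.\<close>
    by (rule tally_swap[THEN conjunct1]; simp)+
qed

theorem theorem1p5:
  fixes n :: nat and p :: "nat \<Rightarrow> nat" and M :: "nat multiset"
    and x y z :: "'a :: comm_semiring_1"
  assumes p_pos: "\<And>i. 1 \<le> i \<Longrightarrow> i \<le> n \<Longrightarrow> p i > 0"
    and M: "M = multiset_of_mults n p"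
  shows "(\<exists>\<phi> \<in> weakly_increasing_trees M \<rightarrow> weakly_increasing_trees M.
            (\<forall>T \<in> weakly_increasing_trees M. \<phi> (\<phi> T) = T) \<and>
            (\<forall>T \<in> weakly_increasing_trees M.
               (odd_nodes T, oe T, ee T) = (oe (\<phi> T), odd_nodes (\<phi> T), ee (\<phi> T)))) \<and>
         (\<Sum>T \<in> weakly_increasing_trees M. x ^ ee T * y ^ oe T * z ^ odd_nodes T) =
         (\<Sum>T \<in> weakly_increasing_trees M. x ^ ee T * y ^ odd_nodes T * z ^ oe T)"
proof
  show "\<exists>\<phi> \<in> weakly_increasing_trees M \<rightarrow> weakly_increasing_trees M.
            (\<forall>T \<in> weakly_increasing_trees M. \<phi> (\<phi> T) = T) \<and>
            (\<forall>T \<in> weakly_increasing_trees M.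
               (odd_nodes T, oe T, ee T) = (oe (\<phi> T), odd_nodes (\<phi> T), ee (\<phi> T)))"
    by (intro bexI[of _ swap_tree])
      (auto simp: swap_tree_swap_tree statistics_swap_tree swap_tree_in_weakly_increasing_trees)
  show "(\<Sum>T \<in> weakly_increasing_trees M. x ^ ee T * y ^ oe T * z ^ odd_nodes T) =
         (\<Sum>T \<in> weakly_increasing_trees M. x ^ ee T * y ^ odd_nodes T * z ^ oe T)"
    by (rule sum.reindex_bij_witness[of _ swap_tree swap_tree])
      (auto simp: swap_tree_swap_tree statistics_swap_tree swap_tree_in_weakly_increasing_trees)
qed

end
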